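(* Let $p$ be an odd prime number. If $-7$ is a non-zero quadratic residue modulo $p$, then the Markoff graph mod $p$ is not planar.
   Context: For a prime $p$, define maps $m_1, m_2, m_3 : \mathbb{F}_p^3 \to \mathbb{F}_p^3$ by $m_1(x,y,z) = (yz-x,y,z)$, $m_2(x,y,z) = (x,xz-y,z)$, $m_3(x,y,z) = (x,y,xy-z)$. These are involutions preserving the polynomial $x^2+y^2+z^2-xyz$. The Markoff graph mod $p$ is the graph whose vertices are the triples $(x,y,z) \in \mathbb{F}_p^3$ with $(x,y,z)\neq(0,0,0)$ and $x^2+y^2+z^2=xyz$ in $\mathbb{F}_p$, with an (undirected) edge joining each vertex $v$ to $m_j(v)$ for $j=1,2,3$. If $m_j(v)=v$ this edge is a self-edge (loop) at $v$; loops do not affect planarity. A graph is planar if it can be drawn in the plane without edges crossing. *)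

theory Defs
  imports "HOL-Analysis.Analysis" "HOL-Number_Theory.Number_Theory"
begin

text \<open>Elements of the field with \<open>p\<close> elements are represented by their residues in
  \<open>{0..<int p}\<close>, the carrier of \<^const>\<open>residue_ring\<close>.\<close>

type_synonym triple = "int \<times> int \<times> int"

fun m1 :: "nat \<Rightarrow> triple \<Rightarrow> triple" where
  "m1 p (x, y, z) = ((y * z - x) mod int p, y, z)"

fun m2 :: "nat \<Rightarrow> triple \<Rightarrow> triple" where
  "m2 p (x, y, z) = (x, (x * z - y) mod int p, z)"

fun m3 :: "nat \<Rightarrow> triple \<Rightarrow> triple" where
  "m3 p (x, y, z) = (x, y, (x * y - z) mod int p)"

definition markoff_verts :: "nat \<Rightarrow> triple set" where
  "markoff_verts p =
    {(x, y, z). x \<in> {0..<int p} \<and> y \<in> {0..<int p} \<and> z \<in> {0..<int p} \<and>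
       (x, y, z) \<noteq> (0, 0, 0) \<and> [x\<^sup>2 + y\<^sup>2 + z\<^sup>2 = x * y * z] (mod int p)}"

text \<open>An edge is the set of its ends, so a fixed point \<open>v\<close> of one of the three maps gives the
  loop \<open>{v}\<close>. No two of the maps give parallel non-loop edges, since each of them changes a
  different coordinate.\<close>

definition markoff_edges :: "nat \<Rightarrow> triple set set" where
  "markoff_edges p = {{v, m v} | v m. v \<in> markoff_verts p \<and> m \<in> {m1 p, m2 p, m3 p}}"

text \<open>A drawing of the graph with vertex set \<open>V\<close> and edge set \<open>E\<close> in the plane, modelled by the
  complex numbers: vertices go to distinct points, edges to arcs joining the images of their ends,
  and an arc meets the vertices and the other arcs only in common ends. Loops do not affect
  planarity and are not drawn.\<close>

definition planar_drawing ::
  "'a set \<Rightarrow> 'a set set \<Rightarrow> ('a \<Rightarrow> complex) \<Rightarrow> ('a set \<Rightarrow> real \<Rightarrow> complex) \<Rightarrow> bool" where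
  "planar_drawing V E \<phi> \<gamma> \<longleftrightarrow>
     inj_on \<phi> V \<and>
     (\<forall>e\<in>{e \<in> E. card e = 2}.
        arc (\<gamma> e) \<and> {pathstart (\<gamma> e), pathfinish (\<gamma> e)} = \<phi> ` e \<and>
        path_image (\<gamma> e) \<inter> \<phi> ` V = \<phi> ` e) \<and>
     (\<forall>e\<in>{e \<in> E. card e = 2}. \<forall>f\<in>{e \<in> E. card e = 2}.
        e \<noteq> f \<longrightarrow> path_image (\<gamma> e) \<inter> path_image (\<gamma> f) = \<phi> ` (e \<inter> f))"

definition planar :: "'a set \<Rightarrow> 'a set set \<Rightarrow> bool" where
  "planar V E \<longleftrightarrow> (\<exists>\<phi> \<gamma>. planar_drawing V E \<phi> \<gamma>)"

lemma markoff_verts_closed: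
  assumes v: "v \<in> markoff_verts p" and m: "m \<in> {m1 p, m2 p, m3 p}"
  shows "m v \<in> markoff_verts p" and "m (m v) = v"
proof -
  obtain x y z where xyz: "v = (x, y, z)" by (cases v)
  have r: "x \<in> {0..<int p}" "y \<in> {0..<int p}" "z \<in> {0..<int p}"
    and c: "[x\<^sup>2 + y\<^sup>2 + z\<^sup>2 = x * y * z] (mod int p)"
    using v by (auto simp: xyz markoff_verts_def)
  then have p: "int p > 0" by auto
  have inv: "(t - (t - u) mod int p) mod int p = u" if "u \<in> {0..<int p}" for t u
    using that by (simp add: mod_diff_right_eq)
  have eq: "[((b * d - a) mod int p)\<^sup>2 + b\<^sup>2 + d\<^sup>2 = ((b * d - a) mod int p) * b * d] (mod int p)"
    if "[a\<^sup>2 + b\<^sup>2 + d\<^sup>2 = a * b * d] (mod int p)" for a b d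
  proof -
    have "[((b * d - a) mod int p)\<^sup>2 + b\<^sup>2 + d\<^sup>2 = (b * d - a)\<^sup>2 + b\<^sup>2 + d\<^sup>2] (mod int p)"
      by (intro cong_add cong_pow cong_refl) (simp add: cong_def)
    also have "(b * d - a)\<^sup>2 + b\<^sup>2 + d\<^sup>2 = (a\<^sup>2 + b\<^sup>2 + d\<^sup>2) + (b * d * b * d - 2 * a * b * d)"
      by (simp add: power2_eq_square algebra_simps)
    also have "[\<dots> = a * b * d + (b * d * b * d - 2 * a * b * d)] (mod int p)"
      using that by (intro cong_add cong_refl)
    also have "a * b * d + (b * d * b * d - 2 * a * b * d) = (b * d - a) * b * d"
      by (simp add: algebra_simps)
    also have "[\<dots> = ((b * d - a) mod int p) * b * d] (mod int p)"
      by (intro cong_mult cong_refl) (simp add: cong_def)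
    finally show ?thesis .
  qed
  show mm: "m (m v) = v"
    using m r inv by (auto simp: xyz)
  have "m v \<noteq> (0, 0, 0)"
  proof
    assume "m v = (0, 0, 0)"
    then have "m (0, 0, 0) = v" using mm by simp
    then show False using m v by (auto simp: markoff_verts_def)
  qed
  moreover have "[y\<^sup>2 + x\<^sup>2 + z\<^sup>2 = y * x * z] (mod int p)"
      "[z\<^sup>2 + x\<^sup>2 + y\<^sup>2 = z * x * y] (mod int p)"
    using c by (simp_all add: ac_simps)
  then have "[((x * z - y) mod int p)\<^sup>2 + x\<^sup>2 + z\<^sup>2 = ((x * z - y) mod int p) * x * z] (mod int p)"
      "[((x * y - z) mod int p)\<^sup>2 + x\<^sup>2 + y\<^sup>2 = ((x * y - z) mod int p) * x * y] (mod int p)"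
    by (auto dest: eq)
  ultimately show "m v \<in> markoff_verts p"
    using m r p eq[OF c] by (auto simp: xyz markoff_verts_def ac_simps)
qed

lemma markoff_edges_subset: "e \<in> markoff_edges p \<Longrightarrow> e \<subseteq> markoff_verts p"
  unfolding markoff_edges_def using markoff_verts_closed(1) by blast

end

theory Submission
  imports Defs
begin

text \<open>If \<open>-7\<close> is a square modulo \<open>p\<close>, then \<open>t\<^sup>2 - t + 2\<close> has a root \<open>z\<close> modulo \<open>p\<close>, and its other root is
  \<open>1 - z\<close>. This makes \<open>(1, 1, z)\<close> a vertex, because \<open>1 + 1 + z\<^sup>2 = z\<close>. When one coordinate is \<open>1\<close>
  or \<open>-1\<close>, the composite of the two moves that fix it has order 3, so the vertices in such a
  plane lie on short cycles. Three hexagons, in the planes where the second coordinate is \<open>1\<close>,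
  the third is \<open>-1\<close> and the first is \<open>1\<close>, meet cyclically along three edges whose ends have
  two coordinates \<open>1\<close> or \<open>-1\<close>. The conjugation \<open>z \<mapsto> 1 - z\<close> swaps the ends of each of these
  edges, and going once round the ring of hexagons has the same effect: the ring is a Moebius
  band. Its boundary is a cycle of twelve vertices and the three common edges join opposite
  vertices of it. This is a Moebius ladder with three rungs, hence a subdivision of the complete
  bipartite graph \<open>K\<^bsub>3,3\<^esub>\<close>.

  That \<open>K\<^bsub>3,3\<^esub>\<close> has no drawing is proved from the Jordan curve theorem. Two vertices
  of one side and the three paths between them through the other side form a theta curve, and the
  remaining vertex reaches each of the three arcs of the theta without touching the other two. But
  each face of a theta curve is bounded by only two of the arcs
  (lemma \<open>theta_no_common_access\<close>). When the third arc runs inside the closed curve formed by the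
  first two, this follows from the way in which it splits that inside; an inversion about a point
  inside the closed curve reduces the other case to this one.\<close>

section \<open>Arcs as point sets\<close>

text \<open>The parametrisation and direction of an arc are forgotten, so that reversing and joining arcs
  become statements about sets with marked ends.\<close>

definition arc_between :: "complex set \<Rightarrow> complex \<Rightarrow> complex \<Rightarrow> bool" where
  "arc_between A a b \<longleftrightarrow>
     (\<exists>g. arc g \<and> path_image g = A \<and> pathstart g = a \<and> pathfinish g = b)"

lemma arc_between_ends: "arc_between A a b \<Longrightarrow> a \<in> A \<and> b \<in> A \<and> a \<noteq> b"
  unfolding arc_between_def by (metis arc_distinct_ends pathfinish_in_path_image pathstart_in_path_image)

lemma arc_between_connected: "arc_between A a b \<Longrightarrow> connected A"
  unfolding arc_between_def by (auto intro: connected_arc_image)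

lemma arc_between_compact: "arc_between A a b \<Longrightarrow> compact A"
  unfolding arc_between_def by (auto intro: compact_arc_image)

lemma arc_between_commute: "arc_between A a b \<Longrightarrow> arc_between A b a"
  unfolding arc_between_def
  by (metis arc_reversepath path_image_reversepath pathfinish_reversepath pathstart_reversepath)

lemma arc_between_Un:
  assumes "arc_between A a b" "arc_between B b c" "A \<inter> B = {b}"
  shows "arc_between (A \<union> B) a c"
proof -
  obtain g h where g: "arc g" "path_image g = A" "pathstart g = a" "pathfinish g = b"
    and h: "arc h" "path_image h = B" "pathstart h = b" "pathfinish h = c"
    using assms(1,2) unfolding arc_between_def by blast
  have "arc (g +++ h)"
    using g h assms(3) by (intro arc_join) auto
  moreover have "path_image (g +++ h) = A \<union> B"
    using g h by (simp add: path_image_join)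
  ultimately show ?thesis
    unfolding arc_between_def using g h by (intro exI[of _ "g +++ h"]) simp
qed

lemma arc_between_image:
  assumes "arc_between A a b" "continuous_on A f" "inj_on f A"
  shows "arc_between (f ` A) (f a) (f b)"
proof -
  obtain g where g: "arc g" "path_image g = A" "pathstart g = a" "pathfinish g = b"
    using assms(1) unfolding arc_between_def by blast
  have "arc (f \<circ> g)"
    using g assms(2,3) unfolding arc_def
    by (auto intro!: path_continuous_image comp_inj_on simp: path_image_def)
  then show ?thesis
    unfolding arc_between_def using g
    by (intro exI[of _ "f \<circ> g"]) (simp add: path_image_compose pathstart_compose pathfinish_compose)
qed

section \<open>Faces of a theta curve\<close>

lemma Jordan_inside_arcs:
  assumes "arc_between A a b" "arc_between B a b" "A \<inter> B = {a, b}"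
  shows "inside (A \<union> B) \<noteq> {}" "open (inside (A \<union> B))" "connected (inside (A \<union> B))"
proof -
  obtain g h where g: "arc g" "path_image g = A" "pathstart g = a" "pathfinish g = b"
    and h: "arc h" "path_image h = B" "pathstart h = b" "pathfinish h = a"
    using assms(1) arc_between_commute[OF assms(2)] unfolding arc_between_def by blast
  have s: "simple_path (g +++ h)"
    using g h assms(3) by (intro simple_path_join_loop) auto
  have i: "path_image (g +++ h) = A \<union> B"
    using g h by (simp add: path_image_join)
  have "pathfinish (g +++ h) = pathstart (g +++ h)" using g h by simp
  from Jordan_inside_outside[OF s this]
  show "inside (A \<union> B) \<noteq> {}" "open (inside (A \<union> B))" "connected (inside (A \<union> B))"
    unfolding i by blast+
qed

lemma connected_subset_inside:
  assumes "connected T" "T \<inter> S = {}" "T \<inter> inside S \<noteq> {}"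
  shows "T \<subseteq> inside S"
proof
  fix y assume y: "y \<in> T"
  obtain x where x: "x \<in> T" "x \<in> inside S" using assms(3) by blast
  have "connected_component (- S) x y"
    unfolding connected_component_def using assms x y by blast
  then show "y \<in> inside S" using x inside_same_component by blast
qed

lemma connected_unbounded_subset_outside:
  assumes "connected T" "T \<inter> S = {}" "\<not> bounded T"
  shows "T \<subseteq> outside S"
proof
  fix x assume x: "x \<in> T"
  have "T \<subseteq> connected_component_set (- S) x"
    using assms x by (intro connected_component_maximal) auto
  then show "x \<in> outside S"
    using assms(3) bounded_subset unfolding outside by blast
qed

text \<open>This is \<open>split_inside_simple_closed_curve\<close> for arcs as point sets: a cross-cut divides the inside
  of a Jordan curve into two parts.\<close>

lemma theta_split:
  assumes "arc_between A1 a b" "arc_between A2 a b" "arc_between A3 a b"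
    and "A1 \<inter> A2 = {a, b}" "A1 \<inter> A3 = {a, b}" "A2 \<inter> A3 = {a, b}"
    and "A3 \<inter> inside (A1 \<union> A2) \<noteq> {}"
  shows "inside (A1 \<union> A3) \<union> inside (A2 \<union> A3) \<union> (A3 - {a, b}) = inside (A1 \<union> A2)"
proof -
  obtain g1 g2 g3 where g: "arc g1" "path_image g1 = A1" "pathstart g1 = a" "pathfinish g1 = b"
     "arc g2" "path_image g2 = A2" "pathstart g2 = a" "pathfinish g2 = b"
     "arc g3" "path_image g3 = A3" "pathstart g3 = a" "pathfinish g3 = b"
    using assms(1-3) unfolding arc_between_def by blast
  have "a \<noteq> b" using arc_between_ends[OF assms(1)] by simp
  show ?thesis
    by (rule split_inside_simple_closed_curve[of g1 a b g2 g3])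
       (use g assms(4-7) \<open>a \<noteq> b\<close> in \<open>simp_all add: arc_imp_simple_path\<close>)
qed

text \<open>The set \<open>B3\<close> brings \<open>q\<close> into the inside of \<open>A1 \<union> A2\<close>, hence into one of the two parts cut out
  by \<open>A3\<close>. Each part is surrounded by \<open>A3\<close> and only one of \<open>A1\<close>, \<open>A2\<close>; the set that leads from \<open>q\<close> to the
  other one cannot leave that part, so it would find this arc strictly inside \<open>A1 \<union> A2\<close>.\<close>

lemma theta_no_common_access_inside:
  assumes A: "arc_between A1 a b" "arc_between A2 a b" "arc_between A3 a b"
    and I: "A1 \<inter> A2 = {a, b}" "A1 \<inter> A3 = {a, b}" "A2 \<inter> A3 = {a, b}"
    and ne: "A3 \<inter> inside (A1 \<union> A2) \<noteq> {}"
    and B: "connected B1" "connected B2" "connected B3" "q \<in> B1" "q \<in> B2" "q \<in> B3"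
    and meet: "B1 \<inter> A1 \<noteq> {}" "B2 \<inter> A2 \<noteq> {}" "B3 \<inter> A3 \<noteq> {}"
    and avoid: "B1 \<inter> (A2 \<union> A3) = {}" "B2 \<inter> (A1 \<union> A3) = {}" "B3 \<inter> (A1 \<union> A2) = {}"
  shows False
proof -
  note split = theta_split[OF A I ne]
  have "B3 \<inter> inside (A1 \<union> A2) \<noteq> {}"
    using split meet(3) avoid(3) I arc_between_ends[OF A(1)] by blast
  then have "q \<in> inside (A1 \<union> A2)"
    using connected_subset_inside[OF B(3) avoid(3)] B(6) by blast
  moreover have "q \<notin> A3" using B(4) avoid(1) by blast
  ultimately consider "q \<in> inside (A1 \<union> A3)" | "q \<in> inside (A2 \<union> A3)"
    using split by blast
  then show False
  proof cases
    case 1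
    then have "B2 \<subseteq> inside (A1 \<union> A3)"
      using connected_subset_inside[OF B(2) avoid(2)] B(5) by blast
    then have "A2 \<inter> inside (A1 \<union> A2) \<noteq> {}" using meet(2) split by blast
    then show False using inside_no_overlap[of "A1 \<union> A2"] by blast
  next
    case 2
    then have "B1 \<subseteq> inside (A2 \<union> A3)"
      using connected_subset_inside[OF B(1) avoid(1)] B(4) by blast
    then have "A1 \<inter> inside (A1 \<union> A2) \<noteq> {}" using meet(1) split by blast
    then show False using inside_no_overlap[of "A1 \<union> A2"] by blast
  qed
qed

text \<open>An inversion about a point inside a Jordan curve exchanges the two sides of the curve. The punctured
  inside becomes unbounded and so lies outside the image curve. If the image of the outside did
  too, then the inside of the image curve could contain only \<open>0\<close>, but it is open and nonempty.\<close>

lemma inversion_outside_meets_inside: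
  fixes c :: complex
  defines "f \<equiv> \<lambda>w. inverse (w - c)"
  assumes A: "arc_between A a b" "arc_between B a b" "A \<inter> B = {a, b}"
    and c: "c \<in> inside (A \<union> B)"
    and T: "T \<inter> outside (A \<union> B) \<noteq> {}"
  shows "f ` T \<inter> inside (f ` A \<union> f ` B) \<noteq> {}"
proof
  assume disj: "f ` T \<inter> inside (f ` A \<union> f ` B) = {}"
  define C where "C = A \<union> B"
  have inj: "inj f" unfolding f_def by (auto intro!: injI)
  have cont: "continuous_on S f" if "c \<notin> S" for S
    unfolding f_def using that by (auto intro!: continuous_intros)
  have cC: "c \<notin> C" and cout: "c \<notin> outside C"
    using c inside_no_overlap[of C] inside_Int_outside[of C] unfolding C_def by blast+
  have opn: "open (inside C)" and con: "connected (inside C)"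
    unfolding C_def using Jordan_inside_arcs[OF A] by blast+
  have fC: "f ` A \<union> f ` B = f ` C" unfolding C_def by blast
  have bC: "bounded C"
    unfolding C_def using A(1,2) by (simp add: arc_between_compact compact_imp_bounded)
  have in_sub: "f ` (inside C - {c}) \<subseteq> outside (f ` C)"
  proof (rule connected_unbounded_subset_outside)
    show "connected (f ` (inside C - {c}))"
      using opn con cont by (intro connected_continuous_image connected_open_delete) auto
    show "f ` (inside C - {c}) \<inter> f ` C = {}"
      using inside_no_overlap[of C] unfolding image_Int[OF inj, symmetric] by blast
    show "\<not> bounded (f ` (inside C - {c}))"
    proof
      assume "bounded (f ` (inside C - {c}))"
      then obtain K where K: "K > 0" "\<And>w. w \<in> inside C - {c} \<Longrightarrow> norm (f w) \<le> K"
        unfolding bounded_pos by auto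
      obtain e where e: "e > 0" "ball c e \<subseteq> inside C"
        using opn c unfolding C_def open_contains_ball by blast
      \<comment> \<open>Points this close to the centre go further out than the supposed bound \<open>K\<close>.\<close>
      define d where "d = min (e / 2) (inverse (2 * K))"
      have d: "d > 0" "d < e" "d \<le> inverse (2 * K)"
        using e K unfolding d_def by (auto simp: min_def)
      have "c + of_real d \<in> ball c e" using d by (simp add: dist_norm)
      then have "norm (f (c + of_real d)) \<le> K" using K(2) d e by auto
      then have "inverse d \<le> K" using d by (simp add: f_def norm_inverse)
      moreover have "inverse d \<ge> 2 * K"
        using d K le_imp_inverse_le by fastforce
      ultimately show False using K(1) by simp
    qed
  qed
  have out_sub: "f ` outside C \<subseteq> outside (f ` C)"
  proof -
    have co: "connected (f ` outside C)"
      using bC cont cout by (intro connected_continuous_image connected_outside) auto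
    have d: "f ` outside C \<inter> f ` C = {}"
      using outside_no_overlap[of C] unfolding image_Int[OF inj, symmetric] by blast
    show ?thesis
    proof (cases "f ` outside C \<inter> inside (f ` C) = {}")
      case True
      then show ?thesis using d inside_Un_outside[of "f ` C"] by blast
    next
      case False
      then have "f ` outside C \<subseteq> inside (f ` C)" by (rule connected_subset_inside[OF co d])
      then show ?thesis using disj T unfolding fC C_def by blast
    qed
  qed
  have "inside (f ` C) \<subseteq> {0}"
  proof
    fix w assume w: "w \<in> inside (f ` C)"
    show "w \<in> {0}"
    proof (rule ccontr)
      assume "w \<notin> {0}"
      then have fw: "f (c + inverse w) = w" and "c + inverse w \<noteq> c" by (auto simp: f_def)
      then have "c + inverse w \<in> (inside C - {c}) \<union> outside C \<union> C"
        using inside_Un_outside[of C] by blast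
      then have "w \<in> outside (f ` C) \<union> f ` C"
        using in_sub out_sub fw by (metis UnE UnI1 UnI2 image_eqI subsetD)
      then show False
        using w inside_no_overlap[of "f ` C"] inside_Int_outside[of "f ` C"] by blast
    qed
  qed
  moreover have "inside (f ` C) \<noteq> {}" "open (inside (f ` C))"
  proof -
    have "arc_between (f ` A) (f a) (f b)" "arc_between (f ` B) (f a) (f b)"
      using A cont cC inj unfolding C_def by (auto intro!: arc_between_image intro: inj_on_subset)
    moreover have "f ` A \<inter> f ` B = {f a, f b}"
      using A(3) inj by (simp flip: image_Int)
    ultimately show "inside (f ` C) \<noteq> {}" "open (inside (f ` C))"
      using Jordan_inside_arcs[of "f ` A" "f a" "f b" "f ` B"] unfolding fC by blast+
  qed
  moreover have "finite (inside (f ` C))"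
    using \<open>inside (f ` C) \<subseteq> {0}\<close> by (rule finite_subset) simp
  ultimately show False
    using finite_imp_not_open by metis
qed

text \<open>The sets \<open>B1\<close>, \<open>B2\<close>, \<open>B3\<close> say that \<open>q\<close> has access to each of the three arcs without touching the
  other two.\<close>

lemma theta_no_common_access:
  assumes A: "arc_between A1 a b" "arc_between A2 a b" "arc_between A3 a b"
    and I: "A1 \<inter> A2 = {a, b}" "A1 \<inter> A3 = {a, b}" "A2 \<inter> A3 = {a, b}"
    and B: "connected B1" "connected B2" "connected B3" "q \<in> B1" "q \<in> B2" "q \<in> B3"
    and meet: "B1 \<inter> A1 \<noteq> {}" "B2 \<inter> A2 \<noteq> {}" "B3 \<inter> A3 \<noteq> {}"
    and avoid: "B1 \<inter> (A2 \<union> A3) = {}" "B2 \<inter> (A1 \<union> A3) = {}" "B3 \<inter> (A1 \<union> A2) = {}"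
  shows False
proof (cases "A3 \<inter> inside (A1 \<union> A2) = {}")
  case False
  then show False using theta_no_common_access_inside[OF A I _ B meet avoid] by blast
next
  case True
  obtain c where c: "c \<in> inside (A1 \<union> A2)" using Jordan_inside_arcs(1)[OF A(1,2) I(1)] by blast
  define f where "f = (\<lambda>w. inverse (w - c))"
  have inj: "inj f" unfolding f_def by (auto intro!: injI)
  have cont: "continuous_on S f" if "c \<notin> S" for S
    unfolding f_def using that by (auto intro!: continuous_intros)
  have cA: "c \<notin> A1" "c \<notin> A2" "c \<notin> A3"
    using c True inside_no_overlap[of "A1 \<union> A2"] by blast+
  have "q \<noteq> c"
  proof
    assume "q = c"
    then have "B3 \<subseteq> inside (A1 \<union> A2)"
      using connected_subset_inside[OF B(3) avoid(3)] B(6) c by blast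
    then show False using True meet(3) by blast
  qed
  \<comment> \<open>The centre \<open>c\<close> may lie on \<open>B1\<close> or \<open>B2\<close>, where the inversion is not continuous. Each \<open>B\<close>
    is therefore enlarged to a whole component, which stays connected without \<open>c\<close>.\<close>
  define D where "D S = connected_component_set (- S) q - {c}" for S
  have D: "connected (f ` D S)" "f q \<in> f ` D S" "f ` D S \<inter> f ` S = {}" "f ` D S \<inter> f ` T \<noteq> {}"
    if "compact S" "connected B" "q \<in> B" "B \<inter> T \<noteq> {}" "B \<inter> S = {}" "c \<notin> T" for S T B
  proof -
    have "open (- S)" using that(1) by (simp add: compact_imp_closed open_Compl)
    then have "connected (D S)"
      unfolding D_def by (intro connected_open_delete open_connected_component) auto
    then show "connected (f ` D S)"
      using cont[of "D S"] by (intro connected_continuous_image) (auto simp: D_def)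
    have sub: "B \<subseteq> connected_component_set (- S) q"
      using that by (intro connected_component_maximal) auto
    then show "f q \<in> f ` D S" using that(3) \<open>q \<noteq> c\<close> by (auto simp: D_def)
    have "D S \<inter> S = {}" unfolding D_def using connected_component_subset[of "- S" q] by blast
    then show "f ` D S \<inter> f ` S = {}" using inj by (simp flip: image_Int)
    have "D S \<inter> T \<noteq> {}" using sub that(4,6) unfolding D_def by blast
    then show "f ` D S \<inter> f ` T \<noteq> {}" by blast
  qed
  have cpt: "compact (A2 \<union> A3)" "compact (A1 \<union> A3)" "compact (A1 \<union> A2)"
    using A arc_between_compact compact_Un by blast+
  note D1 = D[OF cpt(1) B(1,4) meet(1) avoid(1) cA(1)]
   and D2 = D[OF cpt(2) B(2,5) meet(2) avoid(2) cA(2)]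
   and D3 = D[OF cpt(3) B(3,6) meet(3) avoid(3) cA(3)]
  have fA: "arc_between (f ` A1) (f a) (f b)" "arc_between (f ` A2) (f a) (f b)"
     "arc_between (f ` A3) (f a) (f b)"
    using A cont cA inj by (auto intro!: arc_between_image intro: inj_on_subset)
  have fI: "f ` A1 \<inter> f ` A2 = {f a, f b}" "f ` A1 \<inter> f ` A3 = {f a, f b}" "f ` A2 \<inter> f ` A3 = {f a, f b}"
    using I inj by (simp_all flip: image_Int)
  have "A3 \<inter> outside (A1 \<union> A2) \<noteq> {}"
    using True meet(3) avoid(3) inside_Un_outside[of "A1 \<union> A2"] by blast
  from inversion_outside_meets_inside[OF A(1,2) I(1) c this]
  have "f ` A3 \<inter> inside (f ` A1 \<union> f ` A2) \<noteq> {}" unfolding f_def .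
  then show False
    using theta_no_common_access_inside[OF fA fI _ D1(1) D2(1) D3(1) D1(2) D2(2) D3(2) D1(4) D2(4) D3(4)]
      D1(3) D2(3) D3(3) by (simp add: image_Un)
qed

section \<open>Drawings of subdivisions of the complete bipartite graph\<close>

text \<open>The arcs \<open>S 0 j \<union> S 1 j\<close> form a theta curve with ends \<open>x 0\<close> and \<open>x 1\<close>, and the arcs \<open>S 2 j\<close> give
  \<open>x 2\<close> access to each of the three.\<close>

lemma no_K33_of_arcs:
  fixes x y :: "nat \<Rightarrow> complex" and S :: "nat \<Rightarrow> nat \<Rightarrow> complex set"
  assumes arcs: "\<And>i j. i < 3 \<Longrightarrow> j < 3 \<Longrightarrow> arc_between (S i j) (x i) (y j)"
    and meets: "\<And>i j k l. \<lbrakk>i < 3; j < 3; k < 3; l < 3; (i, j) \<noteq> (k, l)\<rbrakk> \<Longrightarrow>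
           S i j \<inter> S k l = {x i, y j} \<inter> {x k, y l}"
    and inj: "inj_on x {..<3}" "inj_on y {..<3}"
  shows False
proof -
  have ne: "x i \<noteq> x k" "y i \<noteq> y k" if "i < 3" "k < 3" "i \<noteq> k" for i k
    using inj that by (auto simp: inj_on_def)
  have xy: "x i \<noteq> y j" if "i < 3" "j < 3" for i j
    using arc_between_ends[OF arcs[OF that]] by blast
  have same_y: "S i j \<inter> S k j = {y j}" if "i < 3" "j < 3" "k < 3" "i \<noteq> k" for i j k
    using meets[of i j k j] ne xy that by auto
  have same_x: "S i j \<inter> S i l = {x i}" if "i < 3" "j < 3" "l < 3" "j \<noteq> l" for i j l
    using meets[of i j i l] ne xy that by auto
  have apart: "S i j \<inter> S k l = {}" if "i < 3" "j < 3" "k < 3" "l < 3" "i \<noteq> k" "j \<noteq> l" for i j k l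
    using meets[of i j k l] ne(1)[of i k] ne(2)[of j l] xy[of i l] xy[of k j] that by auto
  define A where "A j = S 0 j \<union> S 1 j" for j
  have A: "arc_between (A j) (x 0) (x 1)" if "j < 3" for j
    unfolding A_def using that arcs same_y[of 0 j 1]
    by (intro arc_between_Un[where b = "y j"] arc_between_commute[of _ "x 1"]) auto
  have AA: "A j \<inter> A l = {x 0, x 1}" if "j < 3" "l < 3" "j \<noteq> l" for j l
    unfolding A_def using that same_x[of 0 j l] same_x[of 1 j l] apart[of 0 j 1 l] apart[of 1 j 0 l]
    by (simp add: Int_Un_distrib Int_Un_distrib2 insert_commute)
  have con: "connected (S 2 j)" and x2: "x 2 \<in> S 2 j" if "j < 3" for j
    using arcs[of 2 j] that arc_between_connected arc_between_ends by auto
  have SA: "S 2 j \<inter> A j \<noteq> {}" if "j < 3" for j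
    unfolding A_def using that same_y[of 2 j 0] by auto
  have SA': "S 2 j \<inter> (A k \<union> A l) = {}" if "j < 3" "l < 3" "k < 3" "j \<noteq> l" "j \<noteq> k" for j k l
    unfolding A_def using that apart[of 2 j 0 l] apart[of 2 j 1 l] apart[of 2 j 0 k] apart[of 2 j 1 k]
    by (simp add: Int_Un_distrib)
  show False
    by (rule theta_no_common_access[of "A 0" "x 0" "x 1" "A 1" "A 2" "S 2 0" "S 2 1" "S 2 2" "x 2"])
       (simp_all add: A AA con x2 SA SA' del: One_nat_def)
qed

fun walk_edges :: "'a list \<Rightarrow> 'a set set" where
  "walk_edges (u # v # ws) = insert {u, v} (walk_edges (v # ws))"
| "walk_edges ws = {}"

lemma hd_neq_last:
  assumes "distinct vs" "2 \<le> length vs"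
  shows "hd vs \<noteq> last vs"
proof -
  have "vs \<noteq> []" "tl vs \<noteq> []" using assms(2) by (cases vs; auto)+
  then have "last vs \<in> set (tl vs)" by (metis last_in_set last_tl)
  moreover have "hd vs \<notin> set (tl vs)" using assms(1) \<open>vs \<noteq> []\<close> by (cases vs) auto
  ultimately show ?thesis by metis
qed

lemma Union_walk_edges: "2 \<le> length vs \<Longrightarrow> \<Union> (walk_edges vs) = set vs"
proof (induction vs rule: walk_edges.induct)
  case (1 u v ws)
  then show ?case by (cases ws) auto
qed auto

lemma card_walk_edges: "distinct vs \<Longrightarrow> e \<in> walk_edges vs \<Longrightarrow> card e = 2"
  by (induction vs rule: walk_edges.induct) auto

text \<open>Images of edge-disjoint subgraphs meet only in images of common vertices. This turns the
  disjointness of arcs into a question about vertex sets.\<close>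

lemma planar_drawing_Int:
  assumes "planar_drawing V E \<phi> \<gamma>"
    and "F \<subseteq> {e \<in> E. card e = 2}" "G \<subseteq> {e \<in> E. card e = 2}" "F \<inter> G = {}"
  shows "(\<Union>e\<in>F. path_image (\<gamma> e)) \<inter> (\<Union>e\<in>G. path_image (\<gamma> e)) = \<phi> ` (\<Union>F \<inter> \<Union>G)"
proof -
  have "path_image (\<gamma> e) \<inter> path_image (\<gamma> f) = \<phi> ` (e \<inter> f)" if "e \<in> F" "f \<in> G" for e f
  proof -
    have "e \<noteq> f" using assms(4) that by blast
    then show ?thesis using assms(1-3) that unfolding planar_drawing_def by blast
  qed
  then have "(\<Union>e\<in>F. \<Union>f\<in>G. path_image (\<gamma> e) \<inter> path_image (\<gamma> f)) = (\<Union>e\<in>F. \<Union>f\<in>G. \<phi> ` (e \<inter> f))"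
    by (intro SUP_cong refl)
  moreover have "(\<Union>e\<in>F. path_image (\<gamma> e)) \<inter> (\<Union>e\<in>G. path_image (\<gamma> e))
      = (\<Union>e\<in>F. \<Union>f\<in>G. path_image (\<gamma> e) \<inter> path_image (\<gamma> f))"
    by blast
  moreover have "(\<Union>e\<in>F. \<Union>f\<in>G. \<phi> ` (e \<inter> f)) = \<phi> ` (\<Union>F \<inter> \<Union>G)" by auto
  ultimately show ?thesis by (simp only:)
qed

lemma planar_drawing_edge:
  assumes "planar_drawing V E \<phi> \<gamma>" "{u, v} \<in> E" "u \<noteq> v"
  shows "arc_between (path_image (\<gamma> {u, v})) (\<phi> u) (\<phi> v)"
proof -
  have a: "arc (\<gamma> {u, v})" and "{pathstart (\<gamma> {u, v}), pathfinish (\<gamma> {u, v})} = {\<phi> u, \<phi> v}"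
    using assms unfolding planar_drawing_def by auto
  then consider "pathstart (\<gamma> {u, v}) = \<phi> u" "pathfinish (\<gamma> {u, v}) = \<phi> v"
    | "pathstart (\<gamma> {u, v}) = \<phi> v" "pathfinish (\<gamma> {u, v}) = \<phi> u"
    by (auto simp: doubleton_eq_iff)
  then show ?thesis
  proof cases
    case 1
    then show ?thesis using a unfolding arc_between_def by blast
  next
    case 2
    then have "arc_between (path_image (\<gamma> {u, v})) (\<phi> v) (\<phi> u)"
      using a unfolding arc_between_def by blast
    then show ?thesis by (rule arc_between_commute)
  qed
qed

lemma planar_drawing_path:
  assumes d: "planar_drawing V E \<phi> \<gamma>"
    and "distinct vs" "2 \<le> length vs" "walk_edges vs \<subseteq> E"
  shows "arc_between (\<Union>e\<in>walk_edges vs. path_image (\<gamma> e)) (\<phi> (hd vs)) (\<phi> (last vs))"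
  using assms(2-4)
proof (induction vs rule: walk_edges.induct)
  case (1 u v ws)
  have uv: "arc_between (path_image (\<gamma> {u, v})) (\<phi> u) (\<phi> v)"
    using 1 d by (intro planar_drawing_edge) auto
  show ?case
  proof (cases ws)
    case Nil
    then show ?thesis using uv by simp
  next
    case (Cons w ws')
    have len: "2 \<le> length (v # ws)" using Cons by simp
    have IH: "arc_between (\<Union>e\<in>walk_edges (v # ws). path_image (\<gamma> e)) (\<phi> v) (\<phi> (last (v # ws)))"
      using 1 len by simp
    have "{{u, v}} \<inter> walk_edges (v # ws) = {}"
      using 1(2) Union_walk_edges[OF len] by auto
    moreover have "walk_edges (v # ws) \<subseteq> {e \<in> E. card e = 2}"
      using 1(2,4) card_walk_edges[of "v # ws"] by auto
    moreover have "{{u, v}} \<subseteq> {e \<in> E. card e = 2}"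
      using 1(2,4) by auto
    ultimately have "path_image (\<gamma> {u, v}) \<inter> (\<Union>e\<in>walk_edges (v # ws). path_image (\<gamma> e))
        = \<phi> ` ({u, v} \<inter> set (v # ws))"
      using planar_drawing_Int[OF d, of "{{u, v}}" "walk_edges (v # ws)"]
        Union_walk_edges[OF len] by simp
    also have "{u, v} \<inter> set (v # ws) = {v}" using 1(2) by auto
    finally show ?thesis
      using arc_between_Un[OF uv IH] by simp
  qed
qed simp_all

text \<open>The condition on the vertex sets already makes the paths edge-disjoint: two different paths
  share at most one vertex.\<close>

lemma not_planar_if_K33_subdivision:
  fixes x y :: "nat \<Rightarrow> 'a" and P :: "nat \<Rightarrow> nat \<Rightarrow> 'a list"
  assumes V: "\<Union>E \<subseteq> V"
    and path: "\<And>i j. i < 3 \<Longrightarrow> j < 3 \<Longrightarrow> distinct (P i j) \<and> 2 \<le> length (P i j) \<and>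
           walk_edges (P i j) \<subseteq> E \<and> hd (P i j) = x i \<and> last (P i j) = y j"
    and meets: "\<And>i j k l. \<lbrakk>i < 3; j < 3; k < 3; l < 3; (i, j) \<noteq> (k, l)\<rbrakk> \<Longrightarrow>
           set (P i j) \<inter> set (P k l) = {x i, y j} \<inter> {x k, y l}"
    and inj: "inj_on x {..<3}" "inj_on y {..<3}"
  shows "\<not> planar V E"
proof
  assume "planar V E"
  then obtain \<phi> \<gamma> where d: "planar_drawing V E \<phi> \<gamma>" unfolding planar_def by blast
  have phi: "inj_on \<phi> V" using d unfolding planar_drawing_def by blast
  have U: "\<Union> (walk_edges (P i j)) = set (P i j)" and Pne: "P i j \<noteq> []" if "i < 3" "j < 3" for i j
    using path[OF that] by (simp_all add: Union_walk_edges) auto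
  have PV: "set (P i j) \<subseteq> V" if "i < 3" "j < 3" for i j
    unfolding U[OF that, symmetric] using path[OF that] V by blast
  have P2: "walk_edges (P i j) \<subseteq> {e \<in> E. card e = 2}" if "i < 3" "j < 3" for i j
    using path[OF that] card_walk_edges by blast
  have xV: "x i \<in> V" and yV: "y i \<in> V" if "i < 3" for i
  proof -
    have "x i = hd (P i 0)" "y i = last (P 0 i)" using path[of i 0] path[of 0 i] that by auto
    then show "x i \<in> V" "y i \<in> V"
      using PV[of i 0] PV[of 0 i] Pne[of i 0] Pne[of 0 i] that by auto
  qed
  define S where "S i j = (\<Union>e\<in>walk_edges (P i j). path_image (\<gamma> e))" for i j
  show False
  proof (rule no_K33_of_arcs[of S "\<phi> \<circ> x" "\<phi> \<circ> y"])
    show "arc_between (S i j) ((\<phi> \<circ> x) i) ((\<phi> \<circ> y) j)" if "i < 3" "j < 3" for i j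
      unfolding S_def using planar_drawing_path[OF d, of "P i j"] path[OF that] by simp
    show "S i j \<inter> S k l = {(\<phi> \<circ> x) i, (\<phi> \<circ> y) j} \<inter> {(\<phi> \<circ> x) k, (\<phi> \<circ> y) l}"
      if "i < 3" "j < 3" "k < 3" "l < 3" "(i, j) \<noteq> (k, l)" for i j k l
    proof -
      have "walk_edges (P i j) \<inter> walk_edges (P k l) = {}"
      proof (rule ccontr)
        assume "\<not> ?thesis"
        then obtain e where e: "e \<in> walk_edges (P i j)" "e \<in> walk_edges (P k l)" by blast
        have sub: "e \<subseteq> {x i, y j} \<inter> {x k, y l}"
          using e U[OF that(1,2)] U[OF that(3,4)] meets[OF that] by blast
        have "card e = 2" using card_walk_edges e(1) path[OF that(1,2)] by blast
        then obtain u v where uv: "e = {u, v}" "u \<noteq> v" unfolding card_2_iff by blast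
        then have "{x i, y j} = {x k, y l}" using sub by auto
        have "x i \<noteq> y l" if "i < 3" "l < 3" for i l
          using path[OF that] hd_neq_last[of "P i l"] by auto
        then have "x i = x k" "y j = y l"
          using \<open>{x i, y j} = {x k, y l}\<close> that(1-4) by (auto simp: doubleton_eq_iff)
        then show False using inj that by (auto simp: inj_on_def)
      qed
      then have "S i j \<inter> S k l = \<phi> ` ({x i, y j} \<inter> {x k, y l})"
        unfolding S_def using planar_drawing_Int[OF d P2 P2, of i j k l] that
          U[OF that(1,2)] U[OF that(3,4)] meets[OF that] by simp
      also have "\<dots> = \<phi> ` {x i, y j} \<inter> \<phi> ` {x k, y l}"
        using xV yV that by (intro inj_on_image_Int[OF phi]) auto
      finally show ?thesis by simp
    qed
    show "inj_on (\<phi> \<circ> x) {..<3}" "inj_on (\<phi> \<circ> y) {..<3}"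
      using inj xV yV by (auto intro!: comp_inj_on inj_on_subset[OF phi])
  qed
qed

text \<open>The ends of the rungs, read round the rim of the ladder, belong alternately to the two sides of
  \<open>K\<^bsub>3,3\<^esub>\<close>: the three rungs and the six pieces of the rim between them are its nine
  subdivided edges. Each of these pieces has one inner vertex here.\<close>

lemma not_planar_if_Moebius_ladder:
  assumes V: "\<Union>E \<subseteq> V" and inj: "inj_on w {..<12::nat}"
    and cycle: "\<And>i. i < 12 \<Longrightarrow> {w i, w ((i + 1) mod 12)} \<in> E"
    and rungs: "{w 0, w 6} \<in> E" "{w 2, w 8} \<in> E" "{w 4, w 10} \<in> E"
  shows "\<not> planar V E"
proof -
  \<comment> \<open>The entry at \<open>i\<close>, \<open>j\<close> is the path from the branch vertex \<open>4 * i\<close> to the branch vertex \<open>4 * j + 2\<close>.\<close>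
  define Q :: "nat list list list" where
    "Q = [[[0, 1, 2], [0, 6], [0, 11, 10]], [[4, 3, 2], [4, 5, 6], [4, 10]], [[8, 2], [8, 7, 6], [8, 9, 10]]]"
  have three: "i = 0 \<or> i = 1 \<or> i = 2" if "i < 3" for i :: nat using that by auto
  have Q12: "set (Q ! i ! j) \<subseteq> {..<12}" if "i < 3" "j < 3" for i j
    using three[OF that(1)] three[OF that(2)] by (elim disjE) (simp_all add: Q_def)
  have dist: "distinct (Q ! i ! j)" "2 \<le> length (Q ! i ! j)" "hd (Q ! i ! j) = 4 * i" "last (Q ! i ! j) = 4 * j + 2"
    if "i < 3" "j < 3" for i j
    using three[OF that(1)] three[OF that(2)] by (elim disjE; simp add: Q_def)+
  have QQ: "set (Q ! i ! j) \<inter> set (Q ! k ! l) = {4 * i, 4 * j + 2} \<inter> {4 * k, 4 * l + 2}"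
    if "i < 3" "j < 3" "k < 3" "l < 3" "(i, j) \<noteq> (k, l)" for i j k l
    using three[OF that(1)] three[OF that(2)] three[OF that(3)] three[OF that(4)] that(5)
    by (elim disjE) (simp_all add: Q_def)
  have c: "{w 0, w 1} \<in> E" "{w 1, w 2} \<in> E" "{w 2, w 3} \<in> E" "{w 3, w 4} \<in> E" "{w 4, w 5} \<in> E"
    "{w 5, w 6} \<in> E" "{w 6, w 7} \<in> E" "{w 7, w 8} \<in> E" "{w 8, w 9} \<in> E" "{w 9, w 10} \<in> E"
    "{w 10, w 11} \<in> E" "{w 11, w 0} \<in> E"
    using cycle[of 0] cycle[of 1] cycle[of 2] cycle[of 3] cycle[of 4] cycle[of 5] cycle[of 6]
      cycle[of 7] cycle[of 8] cycle[of 9] cycle[of 10] cycle[of 11]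
    by (simp_all del: One_nat_def)
  have QE: "walk_edges (map w (Q ! i ! j)) \<subseteq> E" if "i < 3" "j < 3" for i j
    using three[OF that(1)] three[OF that(2)]
    by (elim disjE) (use c rungs in \<open>simp_all add: Q_def insert_commute\<close>)
  show ?thesis
  proof (rule not_planar_if_K33_subdivision[OF V, of "\<lambda>i j. map w (Q ! i ! j)" "\<lambda>i. w (4 * i)" "\<lambda>j. w (4 * j + 2)"])
    show "distinct (map w (Q ! i ! j)) \<and> 2 \<le> length (map w (Q ! i ! j)) \<and>
        walk_edges (map w (Q ! i ! j)) \<subseteq> E \<and>
        hd (map w (Q ! i ! j)) = w (4 * i) \<and> last (map w (Q ! i ! j)) = w (4 * j + 2)"
      if "i < 3" "j < 3" for i j
    proof -
      have "Q ! i ! j \<noteq> []" using dist(2)[OF that] by auto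
      then show ?thesis
        using dist[OF that] QE[OF that] inj_on_subset[OF inj Q12[OF that]]
        by (simp add: distinct_map hd_map last_map)
    qed
    show "set (map w (Q ! i ! j)) \<inter> set (map w (Q ! k ! l)) =
        {w (4 * i), w (4 * j + 2)} \<inter> {w (4 * k), w (4 * l + 2)}"
      if "i < 3" "j < 3" "k < 3" "l < 3" "(i, j) \<noteq> (k, l)" for i j k l
    proof -
      have "set (map w (Q ! i ! j)) \<inter> set (map w (Q ! k ! l)) = w ` ({4 * i, 4 * j + 2} \<inter> {4 * k, 4 * l + 2})"
        using inj_on_image_Int[OF inj Q12[OF that(1,2)] Q12[OF that(3,4)]] QQ[OF that] by simp
      also have "\<dots> = w ` {4 * i, 4 * j + 2} \<inter> w ` {4 * k, 4 * l + 2}"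
        using that by (intro inj_on_image_Int[OF inj]) auto
      finally show ?thesis by simp
    qed
    show "inj_on (\<lambda>i. w (4 * i)) {..<3}" "inj_on (\<lambda>j. w (4 * j + 2)) {..<3}"
      by (auto intro!: inj_onI dest!: inj_onD[OF inj])
  qed
qed

section \<open>The Moebius ladder in the Markoff graph\<close>

definition red :: "nat \<Rightarrow> int \<Rightarrow> int \<Rightarrow> int \<Rightarrow> triple" where
  "red p a b c = (a mod int p, b mod int p, c mod int p)"

text \<open>The moves are integral polynomial maps, so they can be computed on integers before reduction
  modulo \<open>p\<close>.\<close>

lemma markoff_moves:
  assumes "red p a b c \<in> markoff_verts p"
  shows "red p (b * c - a) b c \<in> markoff_verts p" "red p a (a * c - b) c \<in> markoff_verts p"
      "red p a b (a * b - c) \<in> markoff_verts p"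
    and "{red p a b c, red p (b * c - a) b c} \<in> markoff_edges p"
      "{red p a b c, red p a (a * c - b) c} \<in> markoff_edges p"
      "{red p a b c, red p a b (a * b - c)} \<in> markoff_edges p"
proof -
  have m: "m1 p (red p a b c) = red p (b * c - a) b c" "m2 p (red p a b c) = red p a (a * c - b) c"
    "m3 p (red p a b c) = red p a b (a * b - c)"
    by (auto simp: red_def intro!: mod_diff_cong mod_mult_cong)
  show "red p (b * c - a) b c \<in> markoff_verts p" "red p a (a * c - b) c \<in> markoff_verts p"
      "red p a b (a * b - c) \<in> markoff_verts p"
    unfolding m[symmetric] using assms by (auto intro: markoff_verts_closed(1))
  show "{red p a b c, red p (b * c - a) b c} \<in> markoff_edges p"
      "{red p a b c, red p a (a * c - b) c} \<in> markoff_edges p"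
      "{red p a b c, red p a b (a * b - c)} \<in> markoff_edges p"
    unfolding m[symmetric] markoff_edges_def using assms by blast+
qed

text \<open>The root is \<open>(1 + s) / 2\<close> with \<open>s\<^sup>2 = -7\<close>; adding the odd number \<open>p\<close> to \<open>s\<close> if
  necessary makes \<open>s\<close> odd, and the division is one of integers.\<close>

lemma half_one_plus_sqrt_minus_7:
  fixes p :: int
  assumes "odd p" "QuadRes p (-7)"
  obtains z where "p dvd z\<^sup>2 - z + 2"
proof -
  obtain y where y: "[y\<^sup>2 = -7] (mod p)" using assms(2) unfolding QuadRes_def by blast
  define s where "s = (if odd y then y else y + p)"
  have "odd s" using assms(1) by (simp add: s_def)
  then obtain k where k: "s = 2 * k + 1" by (elim oddE)
  have "[s = y] (mod p)" by (simp add: s_def cong_def)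
  then have "[s\<^sup>2 = -7] (mod p)" using y cong_pow cong_trans by blast
  then have "p dvd s\<^sup>2 + 7" by (simp add: cong_iff_dvd_diff)
  also have "s\<^sup>2 + 7 = 2\<^sup>2 * ((k + 1)\<^sup>2 - (k + 1) + 2)"
    by (simp add: k power2_eq_square algebra_simps)
  finally have "p dvd 2\<^sup>2 * ((k + 1)\<^sup>2 - (k + 1) + 2)" .
  moreover have "coprime p (2\<^sup>2)" using assms(1) unfolding coprime_power_right_iff by simp
  ultimately show ?thesis using that coprime_dvd_mult_right_iff by blast
qed

text \<open>These are the values taken by the coordinates of the ladder. Up to sign and factors 2, their
  differences are \<open>1\<close>, \<open>2\<close>, \<open>z\<close>, \<open>z - 1\<close>, \<open>z + 1\<close>, \<open>z - 2\<close> and \<open>2 * z - 1\<close>. The value of \<open>t\<^sup>2 - t + 2\<close>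
  is \<open>2\<close> at \<open>0\<close> and \<open>1\<close>, and \<open>4\<close> at \<open>-1\<close> and \<open>2\<close>, so none of these is a root; and a double root
  would need the discriminant \<open>-7\<close> to vanish.\<close>

lemma six_distinct_residues:
  fixes p z :: int
  assumes p: "prime p" "odd p" "\<not> p dvd 7" and z: "p dvd z\<^sup>2 - z + 2"
  shows "distinct (map (\<lambda>a. a mod p) [1, -1, z, -z, z - 1, 1 - z])"
proof -
  have 2: "\<not> p dvd 2"
    using primes_dvd_imp_eq[OF p(1) two_is_prime] p(2) by auto
  have 1: "\<not> p dvd 1" using p(1) not_prime_unit by blast
  have 4: "\<not> p dvd 4" using 2 prime_dvd_mult_iff[OF p(1), of 2 2] by simp
  have *: "\<not> p dvd a" if "z\<^sup>2 - z + 2 = a * b + r" "\<not> p dvd r" for a b r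
    using that z by (metis dvd_add_right_iff dvd_mult2)
  have n: "\<not> p dvd z" "\<not> p dvd z - 1" "\<not> p dvd z + 1" "\<not> p dvd z - 2"
    using *[of z "z - 1" 2] *[of "z - 1" z 2] *[of "z + 1" "z - 2" 4] *[of "z - 2" "z + 1" 4] 2 4
    by (simp_all add: power2_eq_square algebra_simps)
  have h: "\<not> p dvd 2 * z - 1"
  proof
    assume "p dvd 2 * z - 1"
    then have "p dvd 4 * (z\<^sup>2 - z + 2) - (2 * z - 1) * (2 * z - 1)"
      using z by (metis dvd_diff dvd_mult)
    also have "4 * (z\<^sup>2 - z + 2) - (2 * z - 1) * (2 * z - 1) = 7"
      by (simp add: power2_eq_square algebra_simps)
    finally show False using p(3) by simp
  qed
  have "\<not> p dvd 1 - z" "\<not> p dvd - 1 - z" "\<not> p dvd 2 - z" "\<not> p dvd 1 - 2 * z"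
    using n h dvd_minus_iff[of p "z - 1"] dvd_minus_iff[of p "1 + z"]
      dvd_minus_iff[of p "z - 2"] dvd_minus_iff[of p "2 * z - 1"]
    by (simp_all add: add.commute)
  moreover have "\<not> p dvd 2 * z" "\<not> p dvd 2 * (z - 1)"
    using n 2 p(1) by (simp_all add: prime_dvd_mult_iff del: right_diff_distrib_numeral)
  ultimately show ?thesis
    using 1 2 n h by (simp add: mod_eq_dvd_iff add.commute)
qed

text \<open>The rim is listed so that the vertex at \<open>i + 6\<close> arises from the one at \<open>i\<close> by exchanging the roots
  \<open>z\<close> and \<open>1 - z\<close>. All steps are identities between polynomials in \<open>z\<close>; the equation for \<open>z\<close>
  makes \<open>(1, 1, z)\<close> a vertex and keeps the twelve triples distinct.\<close>

lemma markoff_not_planar: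
  fixes p :: nat
  assumes p: "prime p" "odd p" and p7: "\<not> int p dvd 7" and z: "int p dvd z\<^sup>2 - z + 2"
  shows "\<not> planar (markoff_verts p) (markoff_edges p)"
proof -
  define w where "w = (!) [red p 1 1 z, red p (z - 1) 1 z, red p (z - 1) 1 (-1),
     red p (z - 1) (-z) (-1), red p 1 (-z) (-1), red p 1 (-z) (1 - z),
     red p 1 1 (1 - z), red p (-z) 1 (1 - z), red p (-z) 1 (-1),
     red p (-z) (z - 1) (-1), red p 1 (z - 1) (-1), red p 1 (z - 1) z]"
  have w: "w 0 = red p 1 1 z" "w 1 = red p (z - 1) 1 z" "w 2 = red p (z - 1) 1 (-1)"
     "w 3 = red p (z - 1) (-z) (-1)" "w 4 = red p 1 (-z) (-1)" "w 5 = red p 1 (-z) (1 - z)"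
     "w 6 = red p 1 1 (1 - z)" "w 7 = red p (-z) 1 (1 - z)" "w 8 = red p (-z) 1 (-1)"
     "w 9 = red p (-z) (z - 1) (-1)" "w 10 = red p 1 (z - 1) (-1)" "w 11 = red p 1 (z - 1) z"
    by (simp_all add: w_def)
  have p0: "int p > 1" using prime_gt_1_nat[OF p(1)] by simp
  have 0: "w 0 \<in> markoff_verts p"
  proof -
    have "[1\<^sup>2 + 1\<^sup>2 + z\<^sup>2 = 1 * 1 * z] (mod int p)"
      using z by (simp add: cong_iff_dvd_diff algebra_simps)
    moreover have "[1\<^sup>2 + 1\<^sup>2 + (z mod int p)\<^sup>2 = 1\<^sup>2 + 1\<^sup>2 + z\<^sup>2] (mod int p)"
      by (intro cong_add cong_pow cong_refl) (simp add: cong_def)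
    moreover have "[1 * 1 * z = 1 * 1 * (z mod int p)] (mod int p)" by (simp add: cong_def)
    ultimately have "[1\<^sup>2 + 1\<^sup>2 + (z mod int p)\<^sup>2 = 1 * 1 * (z mod int p)] (mod int p)"
      using cong_trans by blast
    then show ?thesis
      using p0 by (simp add: w red_def markoff_verts_def)
  qed
  note V1 = markoff_moves(1)[where p = p] and V2 = markoff_moves(2)[where p = p] and V3 = markoff_moves(3)[where p = p]
  have 1: "w 1 \<in> markoff_verts p" using V1[of 1 1 z] 0 by (simp add: w del: One_nat_def)
  have 2: "w 2 \<in> markoff_verts p" using V3[of "z - 1" 1 z] 1 by (simp add: w del: One_nat_def)
  have 3: "w 3 \<in> markoff_verts p" using V2[of "z - 1" 1 "-1"] 2 by (simp add: w del: One_nat_def)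
  have 4: "w 4 \<in> markoff_verts p" using V1[of "z - 1" "-z" "-1"] 3 by (simp add: w del: One_nat_def)
  have 5: "w 5 \<in> markoff_verts p" using V3[of 1 "-z" "-1"] 4 by (simp add: w del: One_nat_def)
  have 6: "w 6 \<in> markoff_verts p" using V2[of 1 "-z" "1 - z"] 5 by (simp add: w del: One_nat_def)
  have 7: "w 7 \<in> markoff_verts p" using V1[of 1 1 "1 - z"] 6 by (simp add: w del: One_nat_def)
  have 8: "w 8 \<in> markoff_verts p" using V3[of "-z" 1 "1 - z"] 7 by (simp add: w del: One_nat_def)
  have 9: "w 9 \<in> markoff_verts p" using V2[of "-z" 1 "-1"] 8 by (simp add: w del: One_nat_def)
  have 10: "w 10 \<in> markoff_verts p" using V1[of "-z" "z - 1" "-1"] 9 by (simp add: w del: One_nat_def)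
  have 11: "w 11 \<in> markoff_verts p" using V3[of 1 "z - 1" "-1"] 10 by (simp add: w del: One_nat_def)
  note E1 = markoff_moves(4)[where p = p] and E2 = markoff_moves(5)[where p = p] and E3 = markoff_moves(6)[where p = p]
  have E: "{w 0, w 1} \<in> markoff_edges p" "{w 1, w 2} \<in> markoff_edges p" "{w 2, w 3} \<in> markoff_edges p"
    "{w 3, w 4} \<in> markoff_edges p" "{w 4, w 5} \<in> markoff_edges p" "{w 5, w 6} \<in> markoff_edges p"
    "{w 6, w 7} \<in> markoff_edges p" "{w 7, w 8} \<in> markoff_edges p" "{w 8, w 9} \<in> markoff_edges p"
    "{w 9, w 10} \<in> markoff_edges p" "{w 10, w 11} \<in> markoff_edges p" "{w 11, w 0} \<in> markoff_edges p"
    using E1[of 1 1 z] 0 E3[of "z - 1" 1 z] 1 E2[of "z - 1" 1 "-1"] 2 E1[of "z - 1" "-z" "-1"] 3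
      E3[of 1 "-z" "-1"] 4 E2[of 1 "-z" "1 - z"] 5 E1[of 1 1 "1 - z"] 6 E3[of "-z" 1 "1 - z"] 7
      E2[of "-z" 1 "-1"] 8 E1[of "-z" "z - 1" "-1"] 9 E3[of 1 "z - 1" "-1"] 10 E2[of 1 "z - 1" z] 11
    by (simp_all add: w del: One_nat_def)
  have R: "{w 0, w 6} \<in> markoff_edges p" "{w 2, w 8} \<in> markoff_edges p" "{w 4, w 10} \<in> markoff_edges p"
    using E3[of 1 1 z] 0 E1[of "z - 1" 1 "-1"] 2 E2[of 1 "-z" "-1"] 4 by (simp_all add: w del: One_nat_def)
  have cycle: "{w i, w ((i + 1) mod 12)} \<in> markoff_edges p" if "i < 12" for i
  proof -
    have "i \<in> {0, 1, 2, 3, 4, 5, 6, 7, 8, 9, 10, 11}"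
      unfolding insert_iff empty_iff using that by presburger
    then show ?thesis using E by (elim insertE emptyE) (simp_all del: One_nat_def)
  qed
  have inj: "inj_on w {..<12}"
  proof -
    have dis: "distinct (map (\<lambda>a. a mod int p) [1, -1, z, -z, z - 1, 1 - z])"
      using p p7 z by (intro six_distinct_residues) auto
    \<comment> \<open>With names for the six residues, the twelve triples are compared symbol by symbol.\<close>
    define e n u v s t where "e = 1 mod int p" "n = -1 mod int p" "u = z mod int p"
      "v = -z mod int p" "s = (z - 1) mod int p" "t = (1 - z) mod int p"
    note defs = this
    have "distinct [e, n, u, v, s, t]" using dis unfolding defs by simp
    then show ?thesis
      unfolding w_def red_def defs[symmetric] by (intro inj_on_nth) auto
  qed
  show ?thesis
    using cycle R markoff_edges_subset by (intro not_planar_if_Moebius_ladder[OF _ inj]) blast+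
qed

theorem theorem1p5:
  fixes p :: nat
  assumes "prime p" and "odd p"
    and "\<not> [-7 = 0] (mod int p)" and "QuadRes (int p) (-7)"
  shows "\<not> planar (markoff_verts p) (markoff_edges p)"
proof -
  obtain z where "int p dvd z\<^sup>2 - z + 2"
    using half_one_plus_sqrt_minus_7[of "int p"] assms(2,4) by auto
  moreover have "\<not> int p dvd 7" using assms(3) by (simp add: cong_0_iff)
  ultimately show ?thesis using assms(1,2) markoff_not_planar by blast
qed

end
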